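(* Let $\eta>0$ and $\kappa>0$ be real, let $p_x,p_y,p_z\ge 0$ be integers, and put $p=p_x+p_y+p_z$. Let $\vec{\mathbf R}=(R_x,R_y,R_z)\in\mathbb{R}^3\setminus\{0\}$. Let $\mathcal{E}_r^{H},\mathcal{E}_r^{Y},\mathcal{E}_r^{C}$ be the functions of $|\vec{\mathbf R}|$ defined by $$\mathcal{E}_r^{H}(|\vec{\mathbf R}|)=\sum_{\pm}\frac{e^{\pm i\kappa|\vec{\mathbf R}|}}{8\pi|\vec{\mathbf R}|}\,\mathrm{erfc}\!\left(\eta|\vec{\mathbf R}|\pm \frac{i\kappa}{2\eta}\right),\qquad \mathcal{E}_r^{Y}(|\vec{\mathbf R}|)=\sum_{\pm}\frac{e^{\pm\kappa|\vec{\mathbf R}|}}{8\pi|\vec{\mathbf R}|}\,\mathrm{erfc}\!\left(\eta|\vec{\mathbf R}|\pm\frac{\kappa}{2\eta}\right),\qquad \mathcal{E}_r^{C}(|\vec{\mathbf R}|)=\frac{\mathrm{erfc}(\eta|\vec{\mathbf R}|)}{4\pi|\vec{\mathbf R}|}.$$ For $0\le m\le p$ let $C_m^{p_x,p_y,p_z}\in\mathbb{R}$ be the coefficient of $s^m$ in the polynomial $H_{p_x}(sR_x)\,H_{p_y}(sR_y)\,H_{p_z}(sR_z)$ in the variable $s$. Then the partial derivatives with respect to the components of $\vec{\mathbf R}$ are as follows. (a) (Helmholtz) $$\partial_x^{p_x}\partial_y^{p_y}\partial_z^{p_z}\mathcal{E}_r^{H}(|\vec{\mathbf R}|)=\frac{(-1)^p}{4\pi^{3/2}|\vec{\mathbf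 R}|}\sum_{m=0}^{p}\sum_{q=0}^{\infty}C_m^{p_x,p_y,p_z}\,\frac{(\kappa^2|\vec{\mathbf R}|^2/4)^q}{q!}\,\frac{\Gamma\!\left(\frac{p+m+1}{2}-q,\ \eta^2|\vec{\mathbf R}|^2\right)}{|\vec{\mathbf R}|^{p+m}}.$$ (b) (Yukawa) $$\partial_x^{p_x}\partial_y^{p_y}\partial_z^{p_z}\mathcal{E}_r^{Y}(|\vec{\mathbf R}|)=\frac{(-1)^p}{4\pi^{3/2}|\vec{\mathbf R}|}\sum_{m=0}^{p}\sum_{q=0}^{\infty}C_m^{p_x,p_y,p_z}\,\frac{(-\kappa^2|\vec{\mathbf R}|^2/4)^q}{q!}\,\frac{\Gamma\!\left(\frac{p+m+1}{2}-q,\ \eta^2|\vec{\mathbf R}|^2\right)}{|\vec{\mathbf R}|^{p+m}}.$$ (c) (Coulomb) $$\partial_x^{p_x}\partial_y^{p_y}\partial_z^{p_z}\mathcal{E}_r^{C}(|\vec{\mathbf R}|)=\frac{(-1)^p}{4\pi^{3/2}|\vec{\mathbf R}|}\sum_{m=0}^{p}C_m^{p_x,p_y,p_z}\,\frac{\Gamma\!\left(\frac{p+m+1}{2},\ \eta^2|\vec{\mathbf R}|^2\right)}{|\vec{\mathbf R}|^{p+m}}.$$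
   Context: $\mathrm{erfc}$ is the complementary error function, extended to an entire function on $\mathbb{C}$: $\mathrm{erfc}(z)=1-\frac{2}{\sqrt{\pi}}\int_0^z e^{-t^2}\,dt$. $\sum_{\pm}$ denotes the sum of the two terms obtained by taking all upper signs, respectively all lower signs. $H_n$ is the physicists' Hermite polynomial, $H_n(u)=(-1)^n e^{u^2}\frac{d^n}{du^n}e^{-u^2}$. $\Gamma(a,x)=\int_x^\infty t^{a-1}e^{-t}\,dt$ is the upper incomplete Gamma function, for real $a$ (possibly zero or negative) and $x>0$. The functions $\mathcal{E}_r^{H},\mathcal{E}_r^{Y},\mathcal{E}_r^{C}$ are the terms of the real-space sum in the Ewald representation of the periodic Helmholtz, Yukawa and Coulomb Green's functions, with splitting parameter $\eta$. *)

theory Defs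
  imports "HOL-Complex_Analysis.Complex_Analysis" "HOL-Computational_Algebra.Polynomial"
begin

definition erfc :: "complex \<Rightarrow> complex" where
  "erfc z = 1 - 2 / of_real (sqrt pi) * contour_integral (linepath 0 z) (\<lambda>t. exp (- (t^2)))"

definition upper_Gamma :: "real \<Rightarrow> real \<Rightarrow> real" where
  "upper_Gamma a x = integral {x..} (\<lambda>t. t powr (a - 1) * exp (- t))"

definition hermite :: "nat \<Rightarrow> real \<Rightarrow> real" where
  "hermite n u = (-1) ^ n * exp (u^2) * (deriv ^^ n) (\<lambda>v. exp (- (v^2))) u"

definition hermite_prod_poly :: "nat \<Rightarrow> nat \<Rightarrow> nat \<Rightarrow> real ^ 3 \<Rightarrow> real poly" where
  "hermite_prod_poly px py pz R =
     (THE P. \<forall>s. poly P s = hermite px (s * R$1) * hermite py (s * R$2) * hermite pz (s * R$3))"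

definition hermite_coeff :: "nat \<Rightarrow> nat \<Rightarrow> nat \<Rightarrow> real ^ 3 \<Rightarrow> nat \<Rightarrow> real" where
  "hermite_coeff px py pz R m = coeff (hermite_prod_poly px py pz R) m"

text \<open>The description in \<^const>\<open>hermite_prod_poly\<close> is well defined.\<close>

lemma deriv_gauss:
  "\<exists>P. (deriv ^^ n) (\<lambda>v::real. exp (- (v^2))) = (\<lambda>u. poly P u * exp (- (u^2)))"
proof (induction n)
  case 0
  show ?case by (rule exI[of _ 1]) simp
next
  case (Suc n)
  then obtain P where P: "(deriv ^^ n) (\<lambda>v::real. exp (- (v^2))) = (\<lambda>u. poly P u * exp (- (u^2)))"
    by blast
  have "deriv (\<lambda>u. poly P u * exp (- (u^2))) u = poly (pderiv P - [:0, 2:] * P) u * exp (- (u^2))" for u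
    by (rule DERIV_imp_deriv) (auto intro!: derivative_eq_intros simp: algebra_simps)
  then have "(deriv ^^ Suc n) (\<lambda>v. exp (- (v^2)))
      = (\<lambda>u. poly (pderiv P - [:0, 2:] * P) u * exp (- (u^2)))"
    by (simp only: funpow.simps comp_apply P) (rule ext)
  then show ?case by blast
qed

lemma hermite_poly_exists: "\<exists>P. \<forall>u. hermite n u = poly P u"
proof -
  obtain P where P: "(deriv ^^ n) (\<lambda>v::real. exp (- (v^2))) = (\<lambda>u. poly P u * exp (- (u^2)))"
    using deriv_gauss by blast
  show ?thesis
    unfolding hermite_def P by (rule exI[of _ "smult ((-1) ^ n) P"]) (simp add: exp_minus)
qed

lemma poly_hermite_prod_poly:
  "poly (hermite_prod_poly px py pz R) s = hermite px (s * R$1) * hermite py (s * R$2) * hermite pz (s * R$3)"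
proof -
  obtain P Q S where "\<And>u. hermite px u = poly P u" "\<And>u. hermite py u = poly Q u" "\<And>u. hermite pz u = poly S u"
    using hermite_poly_exists by metis
  then have "\<forall>s. poly (pcompose P [:0, R$1:] * pcompose Q [:0, R$2:] * pcompose S [:0, R$3:]) s
      = hermite px (s * R$1) * hermite py (s * R$2) * hermite pz (s * R$3)"
    by (simp add: poly_pcompose)
  then have "\<exists>!P. \<forall>s. poly P s = hermite px (s * R$1) * hermite py (s * R$2) * hermite pz (s * R$3)"
    by (intro ex_ex1I) (blast, simp flip: poly_eq_poly_eq_iff add: fun_eq_iff)
  from theI'[OF this] show ?thesis
    by (simp add: hermite_prod_poly_def)
qed

text \<open>Real-space Ewald terms as functions of \<open>r = norm R\<close>; the sign \<open>\<sigma>\<close> ranges over the two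
  choices in \<open>\<Sum>\<close> over plus/minus.\<close>

definition ewald_H :: "real \<Rightarrow> real \<Rightarrow> real \<Rightarrow> complex" where
  "ewald_H \<eta> \<kappa> r = (\<Sum>\<sigma>\<in>{1, -1::complex}.
     exp (\<sigma> * \<i> * of_real (\<kappa> * r)) / of_real (8 * pi * r)
       * erfc (of_real (\<eta> * r) + \<sigma> * (\<i> * of_real \<kappa> / of_real (2 * \<eta>))))"

definition ewald_Y :: "real \<Rightarrow> real \<Rightarrow> real \<Rightarrow> complex" where
  "ewald_Y \<eta> \<kappa> r = (\<Sum>\<sigma>\<in>{1, -1::complex}.
     exp (\<sigma> * of_real (\<kappa> * r)) / of_real (8 * pi * r)
       * erfc (of_real (\<eta> * r) + \<sigma> * (of_real \<kappa> / of_real (2 * \<eta>))))"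

definition ewald_C :: "real \<Rightarrow> real \<Rightarrow> complex" where
  "ewald_C \<eta> r = erfc (of_real (\<eta> * r)) / of_real (4 * pi * r)"

definition partial_deriv :: "3 \<Rightarrow> (real ^ 3 \<Rightarrow> complex) \<Rightarrow> real ^ 3 \<Rightarrow> complex" where
  "partial_deriv i f R = vector_derivative (\<lambda>t. f (R + t *\<^sub>R axis i 1)) (at 0)"

definition partial_exists_on :: "(real ^ 3) set \<Rightarrow> 3 \<Rightarrow> (real ^ 3 \<Rightarrow> complex) \<Rightarrow> bool" where
  "partial_exists_on U i f \<longleftrightarrow> (\<forall>R\<in>U. (\<lambda>t. f (R + t *\<^sub>R axis i 1)) differentiable (at 0))"

definition mixed_partial :: "nat \<Rightarrow> nat \<Rightarrow> nat \<Rightarrow> (real ^ 3 \<Rightarrow> complex) \<Rightarrow> real ^ 3 \<Rightarrow> complex" where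
  "mixed_partial px py pz f =
     (partial_deriv 1 ^^ px) ((partial_deriv 2 ^^ py) ((partial_deriv 3 ^^ pz) f))"

text \<open>\<^const>\<open>vector_derivative\<close> is total, so existence is recorded separately: every differentiation
  step in \<^const>\<open>mixed_partial\<close> must be applied to a function that has the partial derivative
  in question throughout \<open>U\<close>.\<close>

definition mixed_partial_exists_on ::
    "(real ^ 3) set \<Rightarrow> nat \<Rightarrow> nat \<Rightarrow> nat \<Rightarrow> (real ^ 3 \<Rightarrow> complex) \<Rightarrow> bool" where
  "mixed_partial_exists_on U px py pz f \<longleftrightarrow>
     (\<forall>k<pz. partial_exists_on U 3 (mixed_partial 0 0 k f)) \<and>
     (\<forall>k<py. partial_exists_on U 2 (mixed_partial 0 k pz f)) \<and>
     (\<forall>k<px. partial_exists_on U 1 (mixed_partial k py pz f))"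

end

theory Submission
  imports Defs "HOL-Probability.Distributions"
begin

text \<open>
  Differentiating both sides in \<open>\<eta>\<close> and letting \<open>\<eta> \<rightarrow> \<infinity>\<close> shows that each real-space Ewald term is
  \<open>1 / (2 \<pi>\<^sup>3\<^sup>/\<^sup>2) \<integral> exp (- r\<^sup>2 t\<^sup>2 + c / (4 t\<^sup>2)) dt\<close> over \<open>t \<ge> \<eta>\<close>, with \<open>c = \<kappa>\<^sup>2\<close>, \<open>- \<kappa>\<^sup>2\<close> or \<open>0\<close>.
  Under the integral sign, partial differentiation of the Gaussian in \<open>R\<close> produces Hermite
  polynomials in \<open>t R\<close>. Collecting powers of \<open>t\<close>, expanding \<open>exp (c / (4 t\<^sup>2))\<close> and substituting
  \<open>u = r\<^sup>2 t\<^sup>2\<close> turns every resulting integral into an incomplete Gamma function.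
\<close>

section \<open>Truncated Gaussian moments\<close>

text \<open>On \<open>t \<ge> \<eta>\<close> the Gaussian is at most
  \<open>exp (- (s * \<eta> * t))\<close>, so the integrand is majorized by that of a complete Gamma
  integral. The bounded factor \<open>g\<close> makes room for the weight
  \<open>exp (c / (4 * t^2))\<close> and for the terms of its power series.\<close>

lemma absolutely_integrable_gaussian_moment:
  fixes g :: "real \<Rightarrow> real"
  assumes "\<eta> > 0" "s > 0" and g: "continuous_on {\<eta>..} g" "\<And>t. t \<ge> \<eta> \<Longrightarrow> \<bar>g t\<bar> \<le> B"
  shows "(\<lambda>t. t ^ n * exp (- (s * t\<^sup>2)) * g t) absolutely_integrable_on {\<eta>..}"
proof (rule measurable_bounded_by_integrable_imp_absolutely_integrable)
  \<comment> \<open>This is \<open>t ^ n * exp (- (s * \<eta> * t))\<close> in the shape of the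
    complex integrand of Euler's Gamma integral; only its norm enters.\<close>
  define h where "h = (\<lambda>t. complex_of_real t powr (of_nat (Suc n) - 1) / of_real (exp (s * \<eta> * t)))"
  have "h absolutely_integrable_on {0<..}"
    unfolding h_def using assms by (intro absolutely_integrable_Gamma_integral) simp_all
  then have "h absolutely_integrable_on {\<eta>..}"
    by (rule set_integrable_subset) (use assms(1) in \<open>simp_all add: subset_eq\<close>)
  then have "(\<lambda>t. norm (h t)) integrable_on {\<eta>..}"
    by (simp add: absolutely_integrable_on_def)
  then show "(\<lambda>t. B * norm (h t)) integrable_on {\<eta>..}"
    by (rule integrable_on_mult_right)
  show "norm (t ^ n * exp (- (s * t\<^sup>2)) * g t) \<le> B * norm (h t)" if "t \<in> {\<eta>..}" for t
  proof -
    have t: "\<eta> \<le> t" "0 < t" using that assms by auto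
    then have "s * \<eta> * t \<le> s * t\<^sup>2"
      using assms by (simp add: power2_eq_square)
    then have "exp (- (s * t\<^sup>2)) \<le> exp (- (s * \<eta> * t))" by simp
    then have "(t ^ n * exp (- (s * t\<^sup>2))) * \<bar>g t\<bar> \<le> (t ^ n * exp (- (s * \<eta> * t))) * B"
      using t g(2)[of t] by (intro mult_mono) auto
    also have "\<dots> = B * norm (h t)"
    proof -
      have "norm (h t) = t ^ n / exp (s * \<eta> * t)"
        unfolding h_def norm_divide using t by (simp add: norm_powr_real_powr powr_realpow norm_power)
      then show ?thesis by (simp add: exp_minus divide_inverse)
    qed
    finally show ?thesis using t by (simp add: abs_mult)
  qed
  show "(\<lambda>t. t ^ n * exp (- (s * t\<^sup>2)) * g t) \<in> borel_measurable (lebesgue_on {\<eta>..})"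
    by (intro continuous_imp_measurable_on_sets_lebesgue continuous_intros g) auto
qed auto

section \<open>Differentiation under the integral sign\<close>

text \<open>Multiplying \<open>1 - y \<le> exp (- y)\<close> by \<open>exp y\<close> gives
  \<open>exp y - 1 \<le> y * exp y\<close>, so the remainder is at most
  \<open>y * (exp y - 1)\<close>. The second factor \<open>y\<close> comes from the same inequality
  for \<open>y \<ge> 0\<close> and from \<open>1 + y \<le> exp y\<close> for negative
  \<open>y\<close>.\<close>

lemma exp_remainder_bound: "\<bar>exp y - 1 - y\<bar> \<le> y\<^sup>2 * exp \<bar>y\<bar>" for y :: real
proof -
  have 0: "0 \<le> exp y - 1 - y" using exp_ge_add_one_self[of y] by linarith
  have "1 - y \<le> exp (-y)" using exp_ge_add_one_self[of "-y"] by simp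
  then have "(1 - y) * exp y \<le> exp (-y) * exp y" by (intro mult_right_mono) auto
  also have "\<dots> = 1" by (simp flip: exp_add)
  finally have 1: "exp y - 1 \<le> y * exp y" by (simp add: algebra_simps)
  have "exp y - 1 - y \<le> y * (exp y - 1)" using 1 by (simp add: algebra_simps)
  also have "\<dots> \<le> y\<^sup>2 * exp \<bar>y\<bar>"
  proof (cases "y \<ge> 0")
    case True
    then show ?thesis
      using mult_left_mono[OF 1 True] by (simp add: power2_eq_square mult.assoc)
  next
    case False
    have "y * (exp y - 1) = (-y) * (1 - exp y)" by (simp add: algebra_simps)
    also have "\<dots> \<le> (-y) * (-y)" using False 0 by (intro mult_left_mono) auto
    also have "\<dots> \<le> y\<^sup>2 * exp \<bar>y\<bar>"
      using mult_left_mono[of 1 "exp \<bar>y\<bar>" "y\<^sup>2"] by (simp add: power2_eq_square)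
    finally show ?thesis .
  qed
  finally show ?thesis using 0 by simp
qed

text \<open>The last argument \<open>s\<close> stands for the squared radius: it enters the exponent
  linearly, so a derivative in it changes the sign and raises \<open>n\<close> by two.\<close>

definition gauss_moment :: "real \<Rightarrow> real \<Rightarrow> nat \<Rightarrow> real \<Rightarrow> real" where
  "gauss_moment \<eta> c n s = integral {\<eta>..} (\<lambda>t. t ^ n * exp (- (s * t\<^sup>2)) * exp (c / (4 * t\<^sup>2)))"

lemma continuous_gauss_weight:
  "\<eta> > 0 \<Longrightarrow> continuous_on {\<eta>..} (\<lambda>t::real. exp (c / (4 * t\<^sup>2)))"
  by (intro continuous_intros) auto

lemma gauss_weight_bound:
  fixes \<eta> t :: real
  assumes "\<eta> > 0" "t \<ge> \<eta>"
  shows "\<bar>c\<bar> / (4 * t\<^sup>2) \<le> \<bar>c\<bar> / (4 * \<eta>\<^sup>2)" "\<bar>exp (c / (4 * t\<^sup>2))\<bar> \<le> exp (\<bar>c\<bar> / (4 * \<eta>\<^sup>2))"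
proof -
  show 1: "\<bar>c\<bar> / (4 * t\<^sup>2) \<le> \<bar>c\<bar> / (4 * \<eta>\<^sup>2)"
    using assms by (intro divide_left_mono mult_left_mono power_mono mult_pos_pos) auto
  have "c / (4 * t\<^sup>2) \<le> \<bar>c\<bar> / (4 * t\<^sup>2)" by (intro divide_right_mono) auto
  with 1 show "\<bar>exp (c / (4 * t\<^sup>2))\<bar> \<le> exp (\<bar>c\<bar> / (4 * \<eta>\<^sup>2))" by simp
qed

lemma absolutely_integrable_gauss_moment:
  fixes \<eta> s c :: real
  assumes "\<eta> > 0" "s > 0"
  shows "(\<lambda>t. t ^ n * exp (- (s * t\<^sup>2)) * exp (c / (4 * t\<^sup>2))) absolutely_integrable_on {\<eta>..}"
  using assms
  by (intro absolutely_integrable_gaussian_moment[where B = "exp (\<bar>c\<bar> / (4 * \<eta>\<^sup>2))"]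
        continuous_gauss_weight gauss_weight_bound(2)) auto

lemma integrable_gauss_moment:
  fixes \<eta> s c :: real
  assumes "\<eta> > 0" "s > 0"
  shows "(\<lambda>t. t ^ n * exp (- (s * t\<^sup>2)) * exp (c / (4 * t\<^sup>2))) integrable_on {\<eta>..}"
  using absolutely_integrable_gauss_moment[OF assms]
  by (rule set_lebesgue_integral_eq_integral(1))

text \<open>With \<open>y = - h * t^2\<close> the integrand on the left is the original one times
  \<open>exp y - 1 - y\<close>. Since \<open>\<bar>h\<bar> \<le> s / 2\<close>, the factor
  \<open>exp \<bar>y\<bar>\<close> uses up at most half of the Gaussian decay, and
  \<open>y^2\<close> contributes \<open>h^2 * t^4\<close>.\<close>

lemma gauss_moment_remainder_bound:
  assumes \<eta>: "\<eta> > 0" and s: "s > 0" and h: "\<bar>h\<bar> \<le> s / 2"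
  shows "\<bar>gauss_moment \<eta> c n (s + h) - gauss_moment \<eta> c n s + h * gauss_moment \<eta> c (n + 2) s\<bar>
           \<le> h\<^sup>2 * gauss_moment \<eta> c (n + 4) (s / 2)"
proof -
  let ?f = "\<lambda>n s t. t ^ n * exp (- (s * t\<^sup>2)) * exp (c / (4 * t\<^sup>2))"
  have sh: "s + h > 0" using h s by linarith
  note int = integrable_gauss_moment[OF \<eta>]
  have eq: "gauss_moment \<eta> c n (s + h) - gauss_moment \<eta> c n s + h * gauss_moment \<eta> c (n + 2) s
      = integral {\<eta>..} (\<lambda>t. ?f n (s + h) t - ?f n s t + h * ?f (n + 2) s t)"
    unfolding gauss_moment_def
    by (rule integral_unique[symmetric], intro has_integral_add has_integral_diff has_integral_mult_right
          integrable_integral int s sh)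
  have eq2: "h\<^sup>2 * gauss_moment \<eta> c (n + 4) (s / 2) = integral {\<eta>..} (\<lambda>t. h\<^sup>2 * ?f (n + 4) (s / 2) t)"
    unfolding gauss_moment_def by simp
  have "norm (integral {\<eta>..} (\<lambda>t. ?f n (s + h) t - ?f n s t + h * ?f (n + 2) s t))
      \<le> integral {\<eta>..} (\<lambda>t. h\<^sup>2 * ?f (n + 4) (s / 2) t)"
  proof (rule integral_norm_bound_integral)
    show "(\<lambda>t. ?f n (s + h) t - ?f n s t + h * ?f (n + 2) s t) integrable_on {\<eta>..}"
      using int[OF s] int[OF sh] by (intro integrable_add integrable_diff integrable_on_mult_right)
    show "(\<lambda>t. h\<^sup>2 * ?f (n + 4) (s / 2) t) integrable_on {\<eta>..}"
      using int[of "s/2"] s by (intro integrable_on_mult_right) simp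
    fix t assume "t \<in> {\<eta>..}"
    then have t: "t > 0" using \<eta> by auto
    define y where "y = - (h * t\<^sup>2)"
    have "exp (- ((s + h) * t\<^sup>2)) = exp (- (s * t\<^sup>2)) * exp y"
      by (simp add: y_def algebra_simps flip: exp_add)
    then have *: "?f n (s + h) t - ?f n s t + h * ?f (n + 2) s t
        = t ^ n * exp (- (s * t\<^sup>2)) * exp (c / (4 * t\<^sup>2)) * (exp y - 1 - y)"
      by (simp add: y_def algebra_simps power2_eq_square)
    have "\<bar>y\<bar> \<le> s / 2 * t\<^sup>2"
      using mult_right_mono[OF h, of "t\<^sup>2"] by (simp add: y_def abs_mult)
    then have "exp \<bar>y\<bar> \<le> exp (s / 2 * t\<^sup>2)" by simp
    then have "\<bar>exp y - 1 - y\<bar> \<le> y\<^sup>2 * exp (s / 2 * t\<^sup>2)"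
      by (intro order.trans[OF exp_remainder_bound] mult_left_mono) auto
    then have "norm (?f n (s + h) t - ?f n s t + h * ?f (n + 2) s t)
        \<le> t ^ n * exp (- (s * t\<^sup>2)) * exp (c / (4 * t\<^sup>2)) * (y\<^sup>2 * exp (s / 2 * t\<^sup>2))"
      unfolding * using t by (simp add: abs_mult mult_left_mono)
    also have "\<dots> = h\<^sup>2 * (t ^ (n + 4) * (exp (- (s * t\<^sup>2)) * exp (s / 2 * t\<^sup>2)) * exp (c / (4 * t\<^sup>2)))"
      by (simp add: y_def algebra_simps power_add power2_eq_square power4_eq_xxxx)
    also have "exp (- (s * t\<^sup>2)) * exp (s / 2 * t\<^sup>2) = exp (- (s / 2 * t\<^sup>2))"
      by (simp flip: exp_add)
    finally show "norm (?f n (s + h) t - ?f n s t + h * ?f (n + 2) s t) \<le> h\<^sup>2 * ?f (n + 4) (s / 2) t" .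
  qed
  then show ?thesis unfolding eq eq2 by simp
qed

text \<open>The quadratic remainder bound, divided by \<open>h\<close>, is a constant times
  \<open>\<bar>h\<bar>\<close>.\<close>

lemma gauss_moment_has_derivative:
  assumes \<eta>: "\<eta> > 0" and s: "s > 0"
  shows "(gauss_moment \<eta> c n has_real_derivative - gauss_moment \<eta> c (n + 2) s) (at s)"
  unfolding DERIV_def
proof (rule LIM_zero_cancel, rule Lim_null_comparison)
  let ?C = "gauss_moment \<eta> c (n + 4) (s / 2)"
  have "\<forall>\<^sub>F h in at 0. \<bar>h\<bar> < s / 2 \<and> h \<noteq> 0"
    unfolding eventually_at using s by (auto simp: dist_real_def intro!: exI[of _ "s/2"])
  then show "\<forall>\<^sub>F h in at 0. norm ((gauss_moment \<eta> c n (s + h) - gauss_moment \<eta> c n s) / h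
      - - gauss_moment \<eta> c (n + 2) s) \<le> \<bar>h\<bar> * ?C"
  proof eventually_elim
    case (elim h)
    have "(gauss_moment \<eta> c n (s + h) - gauss_moment \<eta> c n s) / h - - gauss_moment \<eta> c (n + 2) s
      = (gauss_moment \<eta> c n (s + h) - gauss_moment \<eta> c n s + h * gauss_moment \<eta> c (n + 2) s) / h"
      using elim by (simp add: field_simps)
    then show ?case
      using gauss_moment_remainder_bound[OF \<eta> s, of h c n] elim
      by (simp add: abs_divide pos_divide_le_eq power2_eq_square algebra_simps)
  qed
  have "((\<lambda>h. \<bar>h\<bar> * ?C) \<longlongrightarrow> \<bar>0\<bar> * ?C) (at 0)" by (intro tendsto_intros)
  then show "((\<lambda>h. \<bar>h\<bar> * ?C) \<longlongrightarrow> 0) (at 0)" by simp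
qed

section \<open>Termwise integration and the passage to incomplete Gamma functions\<close>

text \<open>The weight \<open>exp (c / (4 * t^2))\<close> is expanded and integrated term by term.
  On \<open>t \<ge> \<eta>\<close> its q-th term is at most \<open>B ^ q / fact q\<close>, so the
  terms are dominated by a summable constant times an integrable function, which justifies the
  interchange.\<close>

lemma gauss_moment_sums:
  assumes \<eta>: "\<eta> > 0" and s: "s > 0"
  shows "(\<lambda>q. (c / 4) ^ q / fact q * integral {\<eta>..} (\<lambda>t. t ^ n * exp (- (s * t\<^sup>2)) * (1 / t ^ (2 * q))))
           sums gauss_moment \<eta> c n s"
proof -
  define h where "h = (\<lambda>t. t ^ n * exp (- (s * t\<^sup>2)))"
  define f where "f = (\<lambda>q t. h t * ((c / 4) ^ q / fact q * (1 / t ^ (2 * q))))"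
  \<comment> \<open>Extension by zero, because \<open>sums_integral\<close> integrates over a whole
    measure space; \<open>LINT\<close> translates back.\<close>
  define F where "F = (\<lambda>q t. indicator {\<eta>..} t *\<^sub>R f q t)"
  define B where "B = \<bar>c\<bar> / (4 * \<eta>\<^sup>2)"
  have coef_eq: "(c / 4) ^ q / fact q * (1 / t ^ (2 * q)) = (c / (4 * t\<^sup>2)) ^ q /\<^sub>R fact q" for q t
  proof -
    have "(c / (4 * t\<^sup>2)) ^ q = c ^ q / (4 ^ q * t ^ (2 * q))"
      by (simp only: power_divide power_mult_distrib power_mult)
    then show ?thesis by (simp only: power_divide) (simp add: divide_inverse mult_ac)
  qed
  then have fexp: "f q t = h t * ((c / (4 * t\<^sup>2)) ^ q /\<^sub>R fact q)" for q t
    by (simp only: f_def)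
  have h: "h absolutely_integrable_on {\<eta>..}"
    using absolutely_integrable_gaussian_moment[OF \<eta> s, of "\<lambda>_. 1" 1 n] by (simp add: h_def)
  have h_nonneg: "h t \<ge> 0" if "t \<ge> \<eta>" for t using that \<eta> by (simp add: h_def)
  have coef: "\<bar>(c / (4 * t\<^sup>2)) ^ q /\<^sub>R fact q\<bar> \<le> B ^ q /\<^sub>R fact q" if "t \<ge> \<eta>" for q t
    using gauss_weight_bound(1)[OF \<eta> that, of c]
    by (auto simp: B_def abs_mult power_abs abs_divide intro!: mult_left_mono power_mono)
  have f_bound: "\<bar>f q t\<bar> \<le> B ^ q /\<^sub>R fact q * h t" if "t \<ge> \<eta>" for q t
    using mult_right_mono[OF coef[OF that] h_nonneg[OF that], of q] h_nonneg[OF that]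
    by (simp add: fexp abs_mult mult_ac)
  have F_bound: "norm (F q t) \<le> B ^ q /\<^sub>R fact q * (indicator {\<eta>..} t *\<^sub>R h t)" for q t
    using f_bound[of t q] by (cases "t \<ge> \<eta>") (simp_all add: F_def)
  have int: "f q absolutely_integrable_on {\<eta>..}" for q
    unfolding f_def h_def
  proof (rule absolutely_integrable_gaussian_moment[OF \<eta> s])
    show "continuous_on {\<eta>..} (\<lambda>t. (c / 4) ^ q / fact q * (1 / t ^ (2 * q)))"
      using \<eta> by (intro continuous_intros) auto
    show "\<bar>(c / 4) ^ q / fact q * (1 / t ^ (2 * q))\<bar> \<le> B ^ q /\<^sub>R fact q" if "t \<ge> \<eta>" for t
      unfolding coef_eq by (rule coef[OF that])
  qed
  have LINT: "integral\<^sup>L lebesgue (F q) = integral {\<eta>..} (f q)" for q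
    using set_lebesgue_integral_eq_integral(2)[OF int] by (simp add: F_def set_lebesgue_integral_def)
  have "(\<lambda>q. integral\<^sup>L lebesgue (F q)) sums (\<integral>t. (\<Sum>q. F q t) \<partial>lebesgue)"
  proof (rule sums_integral)
    show F_int: "integrable lebesgue (F q)" for q
      using int[of q] by (simp add: F_def set_integrable_def)
    show "AE t in lebesgue. summable (\<lambda>q. norm (F q t))"
    proof (intro AE_I2)
      fix t
      show "summable (\<lambda>q. norm (F q t))"
        by (rule summable_comparison_test'[where N = 0,
              OF summable_mult2[OF summable_exp_generic[of B], of "indicator {\<eta>..} t *\<^sub>R h t"]])
           (use F_bound[of _ t] in simp)
    qed
    have "(\<integral>t. norm (F q t) \<partial>lebesgue) \<le> B ^ q /\<^sub>R fact q * (\<integral>t. indicator {\<eta>..} t *\<^sub>R h t \<partial>lebesgue)" for q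
      unfolding integral_mult_right_zero[symmetric]
      using F_int h F_bound by (intro integral_mono) (simp_all add: set_integrable_def)
    then show "summable (\<lambda>q. \<integral>t. norm (F q t) \<partial>lebesgue)"
      by (intro summable_comparison_test'[where N = 0,
            OF summable_mult2[OF summable_exp_generic[of B], of "\<integral>t. indicator {\<eta>..} t *\<^sub>R h t \<partial>lebesgue"]])
         simp
  qed
  also have "(\<lambda>t. \<Sum>q. F q t) = (\<lambda>t. indicator {\<eta>..} t *\<^sub>R (h t * exp (c / (4 * t\<^sup>2))))"
  proof
    fix t
    have "(\<lambda>q. f q t) sums (h t * exp (c / (4 * t\<^sup>2)))"
      unfolding fexp by (intro sums_mult exp_converges)
    then have "(\<lambda>q. F q t) sums (indicator {\<eta>..} t *\<^sub>R (h t * exp (c / (4 * t\<^sup>2))))"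
      unfolding F_def by (rule sums_scaleR_right)
    then show "(\<Sum>q. F q t) = indicator {\<eta>..} t *\<^sub>R (h t * exp (c / (4 * t\<^sup>2)))"
      by (rule sums_unique[symmetric])
  qed
  also have "(\<integral>t. indicator {\<eta>..} t *\<^sub>R (h t * exp (c / (4 * t\<^sup>2))) \<partial>lebesgue) = gauss_moment \<eta> c n s"
    using set_lebesgue_integral_eq_integral(2)[OF absolutely_integrable_gauss_moment[OF \<eta> s, of n c]]
    by (simp add: set_lebesgue_integral_def gauss_moment_def h_def)
  finally have "(\<lambda>q. integral {\<eta>..} (f q)) sums gauss_moment \<eta> c n s"
    by (simp add: LINT)
  moreover have "integral {\<eta>..} (f q) = (c / 4) ^ q / fact q * integral {\<eta>..} (\<lambda>t. h t * (1 / t ^ (2 * q)))" for q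
    unfolding integral_mult_right[symmetric] f_def by (simp only: mult_ac)
  ultimately show ?thesis by (simp add: h_def)
qed

text \<open>Substitute \<open>u = r^2 * t^2\<close>: with the Jacobian \<open>2 * r^2 * t\<close>,
  the power of \<open>u\<close> becomes \<open>(r * t)\<close> to the exponent
  \<open>n - 2 * q - 1\<close> and one factor \<open>t\<close> is regained. The power
  \<open>1 / t ^ (2 * q)\<close> stays a quotient because \<open>n - 2 * q\<close> may be
  negative.\<close>

lemma upper_Gamma_eq_gaussian_integral:
  assumes \<eta>: "\<eta> > 0" and r: "r > 0"
  shows "upper_Gamma ((real n + 1) / 2 - real q) (\<eta>\<^sup>2 * r\<^sup>2)
           = 2 * r ^ (n + 1) / r ^ (2 * q) * integral {\<eta>..} (\<lambda>t. t ^ n * exp (- (r\<^sup>2 * t\<^sup>2)) * (1 / t ^ (2 * q)))"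
proof -
  define a where "a = (real n + 1) / 2 - real q"
  define I where "I = integral {\<eta>..} (\<lambda>t. t ^ n * exp (- (r\<^sup>2 * t\<^sup>2)) * (1 / t ^ (2 * q)))"
  let ?K = "2 * r ^ (n + 1) / r ^ (2 * q)"
  let ?f = "\<lambda>u. u powr (a - 1) * exp (- u)"
  let ?g = "\<lambda>t. r\<^sup>2 * t\<^sup>2"
  have image: "?g ` {\<eta>..} = {\<eta>\<^sup>2 * r\<^sup>2..}"
  proof (intro equalityI subsetI)
    fix u assume u: "u \<in> {\<eta>\<^sup>2 * r\<^sup>2..}"
    have "(\<eta> * r)\<^sup>2 \<le> u" using u by (simp add: power_mult_distrib)
    then have "\<eta> * r \<le> sqrt u" using \<eta> r by (simp add: real_le_rsqrt)
    then have "sqrt u / r \<in> {\<eta>..}" using r by (simp add: field_simps)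
    moreover have "u \<ge> 0" using \<open>(\<eta> * r)\<^sup>2 \<le> u\<close> zero_le_power2 order_trans by blast
    then have "?g (sqrt u / r) = u" using r by (simp add: power_divide)
    ultimately show "u \<in> ?g ` {\<eta>..}" by force
  qed (use \<eta> r in \<open>auto intro!: power_mono simp: mult.commute\<close>)
  have eq: "\<bar>2 * r\<^sup>2 * t\<bar> * ?f (?g t) = ?K * (t ^ n * exp (- (r\<^sup>2 * t\<^sup>2)) * (1 / t ^ (2 * q)))"
    if "t \<in> {\<eta>..}" for t
  proof -
    have t: "t > 0" using that \<eta> by auto
    have rt: "r * t > 0" using r t by simp
    have "?g t powr (a - 1) = (r * t) powr (2 * (a - 1))"
    proof -
      have "?g t = (r * t) powr 2" using rt by (simp add: power_mult_distrib)
      then show ?thesis by (simp add: powr_powr)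
    qed
    also have "2 * (a - 1) = real n - real (2 * q) - 1" by (simp add: a_def field_simps)
    also have "(r * t) powr \<dots> = (r * t) ^ n / (r * t) ^ (2 * q) / (r * t)"
      using rt by (simp only: powr_diff powr_realpow powr_one)
    finally have "\<bar>2 * r\<^sup>2 * t\<bar> * (?g t powr (a - 1)) = ?K * (t ^ n * (1 / t ^ (2 * q)))"
      using r t by (simp add: abs_mult power_mult_distrib field_simps power2_eq_square)
    from arg_cong[OF this, of "\<lambda>x. x * exp (- (r\<^sup>2 * t\<^sup>2))"] show ?thesis by (simp only: mult_ac)
  qed
  have "(\<lambda>t. t ^ n * exp (- (r\<^sup>2 * t\<^sup>2)) * (1 / t ^ (2 * q))) absolutely_integrable_on {\<eta>..}"
  proof (rule absolutely_integrable_gaussian_moment[OF \<eta>])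
    show "continuous_on {\<eta>..} (\<lambda>t. 1 / t ^ (2 * q))" using \<eta> by (intro continuous_intros) auto
    show "\<bar>1 / t ^ (2 * q)\<bar> \<le> 1 / \<eta> ^ (2 * q)" if "t \<ge> \<eta>" for t
      using that \<eta> by (auto simp: abs_divide intro!: divide_left_mono power_mono)
  qed (use r in simp)
  then have "(\<lambda>t. ?K * (t ^ n * exp (- (r\<^sup>2 * t\<^sup>2)) * (1 / t ^ (2 * q)))) absolutely_integrable_on {\<eta>..}"
    by (rule set_integrable_mult_right)
  then have abs: "(\<lambda>t. \<bar>2 * r\<^sup>2 * t\<bar> * ?f (?g t)) absolutely_integrable_on {\<eta>..}"
    by (subst set_integrable_cong[OF refl refl eq]) auto
  have val: "integral {\<eta>..} (\<lambda>t. \<bar>2 * r\<^sup>2 * t\<bar> * ?f (?g t)) = ?K * I"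
    unfolding I_def integral_mult_right[symmetric] by (intro integral_cong eq)
  have "inj_on ?g {\<eta>..}"
    using \<eta> r by (auto intro!: inj_onI simp: power2_eq_iff_nonneg)
  moreover have "(?g has_field_derivative 2 * r\<^sup>2 * t) (at t within {\<eta>..})" for t
    by (auto intro!: derivative_eq_intros)
  \<comment> \<open>The change of variables theorem is an equivalence, so facts about the integral
    in \<open>t\<close> yield both integrability and value of the integral in
    \<open>u\<close>.\<close>
  ultimately have "?f absolutely_integrable_on (?g ` {\<eta>..}) \<and> integral (?g ` {\<eta>..}) ?f = ?K * I"
    using abs val
    by (subst has_absolute_integral_change_of_variables_1'[symmetric, where g' = "\<lambda>t. 2 * r\<^sup>2 * t"]) auto
  then show ?thesis
    unfolding image upper_Gamma_def a_def I_def by blast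
qed

section \<open>The error function and the Ewald integral representation\<close>

text \<open>The integrand is entire and the plane is convex, so a global primitive exists. From here
  on contour integrals give way to derivatives.\<close>

lemma erfc_eq_primitive:
  obtains g where "\<And>z. (g has_field_derivative exp (- z\<^sup>2)) (at z)"
    and "\<And>z. erfc z = 1 - 2 / of_real (sqrt pi) * (g z - g 0)"
proof -
  have "(\<lambda>z::complex. exp (- z\<^sup>2)) holomorphic_on UNIV" by (intro holomorphic_intros)
  then obtain g where g: "\<And>z::complex. (g has_field_derivative exp (- z\<^sup>2)) (at z)"
    using holomorphic_convex_primitive'[of UNIV "\<lambda>z. exp (- z\<^sup>2)"] by auto
  have "contour_integral (linepath 0 z) (\<lambda>t. exp (- t\<^sup>2)) = g z - g 0" for z
    using contour_integral_primitive[of UNIV g "\<lambda>t. exp (- t\<^sup>2)" "linepath 0 z"] g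
    by (intro contour_integral_unique) auto
  then show ?thesis
    by (intro that[of g] g) (simp add: erfc_def)
qed

lemma has_field_derivative_erfc:
  "(erfc has_field_derivative - (2 / of_real (sqrt pi) * exp (- z\<^sup>2))) (at z)"
proof -
  obtain g where g: "\<And>z. (g has_field_derivative exp (- z\<^sup>2)) (at z)"
    and erfc: "\<And>z. erfc z = 1 - 2 / of_real (sqrt pi) * (g z - g 0)"
    using erfc_eq_primitive by blast
  have "erfc = (\<lambda>z. 1 - 2 / of_real (sqrt pi) * (g z - g 0))"
    by (rule ext) (rule erfc)
  moreover have "((\<lambda>z. 1 - 2 / of_real (sqrt pi) * (g z - g 0)) has_field_derivative
      0 - 2 / of_real (sqrt pi) * (exp (- z\<^sup>2) - 0)) (at z)"
    by (intro DERIV_diff DERIV_cmult DERIV_const g)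
  ultimately show ?thesis by simp
qed

lemma erfc_0 [simp]: "erfc 0 = 1"
  by (rule erfc_eq_primitive) simp

section \<open>Behaviour at infinity\<close>

lemma tendsto_integral_atLeast:
  fixes f :: "real \<Rightarrow> real"
  assumes f: "f absolutely_integrable_on {a..}"
  shows "((\<lambda>b. integral {a..b} f) \<longlongrightarrow> integral {a..} f) at_top"
proof -
  have "set_lebesgue_integral lebesgue {a..b} f = integral {a..b} f" for b
    by (intro set_lebesgue_integral_eq_integral set_integrable_subset[OF f]) auto
  moreover have "set_lebesgue_integral lebesgue {a..} f = integral {a..} f"
    by (rule set_lebesgue_integral_eq_integral) (rule f)
  ultimately show ?thesis
    using tendsto_set_lebesgue_integral_at_top[OF _ f] by simp
qed

text \<open>On the real axis this is the value \<open>sqrt pi / 2\<close> of the Gaussian integral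
  over the half-line, which cancels the leading 1.\<close>

lemma erfc_of_real_tendsto_0: "((\<lambda>x. erfc (of_real x)) \<longlongrightarrow> 0) at_top"
proof -
  let ?f = "\<lambda>x::real. exp (- x\<^sup>2)"
  have eq: "erfc (of_real b) = of_real (1 - 2 / sqrt pi * integral {0..b} ?f)" if "b \<ge> 0" for b
  proof -
    have "((\<lambda>t. - (2 / of_real (sqrt pi) * exp (- (complex_of_real t)\<^sup>2))) has_integral
        erfc (of_real b) - erfc (of_real 0)) {0..b}"
      using that
      by (intro fundamental_theorem_of_calculus has_vector_derivative_real_field has_field_derivative_erfc)
    moreover have "((\<lambda>t. complex_of_real (- (2 / sqrt pi * ?f t))) has_integral
        of_real (- (2 / sqrt pi * integral {0..b} ?f))) {0..b}"
      by (intro has_integral_of_real has_integral_neg has_integral_mult_right integrable_integral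
            integrable_continuous_interval continuous_intros)
    ultimately have "erfc (of_real b) - erfc (of_real 0) = of_real (- (2 / sqrt pi * integral {0..b} ?f))"
      by (intro has_integral_unique) (auto simp: exp_of_real[symmetric])
    then show ?thesis by (simp add: algebra_simps)
  qed
  have int: "set_integrable lborel {0..} ?f" and val: "set_lebesgue_integral lborel {0..} ?f = sqrt pi / 2"
    using gaussian_moment_0
    by (auto simp: set_integrable_def set_lebesgue_integral_def has_bochner_integral_iff)
  have "set_lebesgue_integral lborel {0..b} ?f = integral {0..b} ?f" for b
    by (intro set_borel_integral_eq_integral set_integrable_subset[OF int]) auto
  then have "((\<lambda>b. integral {0..b} ?f) \<longlongrightarrow> sqrt pi / 2) at_top"
    using tendsto_set_lebesgue_integral_at_top[OF _ int] val by simp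
  then have "((\<lambda>b. complex_of_real (1 - 2 / sqrt pi * integral {0..b} ?f))
      \<longlongrightarrow> of_real (1 - 2 / sqrt pi * (sqrt pi / 2))) at_top"
    by (intro tendsto_intros)
  then have "((\<lambda>b. complex_of_real (1 - 2 / sqrt pi * integral {0..b} ?f)) \<longlongrightarrow> 0) at_top"
    by simp
  then show ?thesis
    by (rule Lim_transform_eventually)
       (use eq in \<open>auto intro!: eventually_mono[OF eventually_ge_at_top[of 0]]\<close>)
qed

text \<open>In a horizontal strip \<open>exp (- z^2)\<close> is bounded, since its modulus is
  \<open>exp ((Im z)^2 - (Re z)^2)\<close>. The strip is convex, so \<open>erfc\<close> is Lipschitz
  there, and for \<open>t \<ge> 1\<close> it contains both arguments, whose distance
  \<open>norm \<nu> / t\<close> tends to 0.\<close>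

lemma erfc_perturbed_tendsto_0:
  assumes r: "r > 0"
  shows "((\<lambda>t. erfc (of_real (t * r) + \<nu> / of_real t)) \<longlongrightarrow> 0) at_top"
proof -
  define B where "B = 2 / sqrt pi * exp ((norm \<nu>)\<^sup>2)"
  let ?S = "{z. Im z \<le> norm \<nu>} \<inter> {z. Im z \<ge> - norm \<nu>}"
  have lim: "((\<lambda>t. erfc (of_real (t * r))) \<longlongrightarrow> 0) at_top"
    by (rule filterlim_compose[OF erfc_of_real_tendsto_0])
       (use r in \<open>auto intro!: filterlim_at_top_mult_tendsto_pos filterlim_ident\<close>)
  have bound: "norm (erfc (of_real (t * r) + \<nu> / of_real t) - erfc (of_real (t * r))) \<le> B * (norm \<nu> / t)"
    if t: "t \<ge> 1" for t
  proof -
    have "norm (\<nu> / of_real t) \<le> norm \<nu>"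
      using t divide_left_mono[of 1 t "norm \<nu>"] by (simp add: norm_divide)
    then have "\<bar>Im (\<nu> / of_real t)\<bar> \<le> norm \<nu>" using abs_Im_le_cmod order_trans by blast
    then have "Im (\<nu> / of_real t) \<le> norm \<nu>" "- norm \<nu> \<le> Im (\<nu> / of_real t)" by linarith+
    then have mem: "of_real (t * r) + \<nu> / of_real t \<in> ?S" by simp
    have "norm (erfc (of_real (t * r) + \<nu> / of_real t) - erfc (of_real (t * r)))
        \<le> B * norm (of_real (t * r) + \<nu> / of_real t - of_real (t * r))"
    proof (rule field_differentiable_bound[of ?S erfc])
      show "convex ?S" by (intro convex_Int convex_halfspace_Im_ge convex_halfspace_Im_le)
      show "(erfc has_field_derivative - (2 / of_real (sqrt pi) * exp (- z\<^sup>2))) (at z within ?S)" for z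
        using has_field_derivative_erfc by (rule has_field_derivative_at_within)
      show "norm (- (2 / of_real (sqrt pi) * exp (- z\<^sup>2))) \<le> B" if "z \<in> ?S" for z
      proof -
        have "(Im z)\<^sup>2 \<le> (norm \<nu>)\<^sup>2" using that by (intro abs_le_square_iff[THEN iffD1]) auto
        then have "Re (- z\<^sup>2) \<le> (norm \<nu>)\<^sup>2" using zero_le_power2[of "Re z"]
          unfolding uminus_complex.sel Re_power2 by linarith
        then have "exp (Re (- z\<^sup>2)) \<le> exp ((norm \<nu>)\<^sup>2)" by (simp only: exp_le_cancel_iff)
        then have "2 / sqrt pi * exp (Re (- z\<^sup>2)) \<le> B"
          unfolding B_def by (intro mult_left_mono) auto
        then show ?thesis by (simp only: norm_minus_cancel norm_mult norm_divide norm_exp_eq_Re) simp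
      qed
    qed (use mem in auto)
    then show ?thesis using t by (simp add: norm_divide)
  qed
  have "((\<lambda>t. erfc (of_real (t * r) + \<nu> / of_real t) - erfc (of_real (t * r))) \<longlongrightarrow> 0) at_top"
  proof (rule Lim_null_comparison)
    show "\<forall>\<^sub>F t in at_top. norm (erfc (of_real (t * r) + \<nu> / of_real t) - erfc (of_real (t * r)))
        \<le> B * (norm \<nu> / t)"
      using eventually_ge_at_top[of 1] by eventually_elim (rule bound)
    show "((\<lambda>t. B * (norm \<nu> / t)) \<longlongrightarrow> 0) at_top"
      by (intro tendsto_mult_right_zero tendsto_divide_0[OF tendsto_const] filterlim_at_top_imp_at_infinity filterlim_ident)
  qed
  from tendsto_add[OF this lim] show ?thesis by simp
qed

text \<open>The splitting parameter becomes a complex variable \<open>w\<close>, and \<open>\<mu>\<close> is \<open>\<i> * \<kappa>\<close>, \<open>\<kappa>\<close> or \<open>0\<close>.\<close>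

definition ewald_term :: "complex \<Rightarrow> real \<Rightarrow> complex \<Rightarrow> complex" where
  "ewald_term \<mu> r w = (\<Sum>\<sigma>\<in>{1, -1::complex}.
     exp (\<sigma> * \<mu> * of_real r) / of_real (8 * pi * r) * erfc (w * of_real r + \<sigma> * (\<mu> / (2 * w))))"

text \<open>Expanding the square of the \<open>erfc\<close> argument gives
  \<open>r^2 * w^2 + \<sigma> * \<mu> * r + \<mu>^2 / (4 * w^2)\<close>, because
  \<open>\<sigma>^2 = 1\<close>. The prefactor cancels the cross term, so both signs carry the same
  exponential; the inner derivatives \<open>r - \<sigma> * \<mu> / (2 * w^2)\<close> then add up to
  \<open>2 * r\<close>, which cancels the \<open>r\<close> in the denominator.\<close>

lemma ewald_term_has_field_derivative:
  assumes w: "w \<noteq> 0" and r: "r > 0"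
  shows "(ewald_term \<mu> r has_field_derivative
           - (exp (- (of_real (r\<^sup>2) * w\<^sup>2)) * exp (- \<mu>\<^sup>2 / (4 * w\<^sup>2)) / of_real (2 * pi * sqrt pi))) (at w)"
proof -
  let ?D = "\<lambda>\<sigma>. exp (\<sigma> * \<mu> * of_real r) / of_real (8 * pi * r) *
     (- (2 / of_real (sqrt pi) * exp (- (w * of_real r + \<sigma> * (\<mu> / (2 * w)))\<^sup>2)) * (of_real r - \<sigma> * (\<mu> / (2 * w\<^sup>2))))"
  have inner: "((\<lambda>w. w * of_real r + \<sigma> * (\<mu> / (2 * w))) has_field_derivative
      of_real r - \<sigma> * (\<mu> / (2 * w\<^sup>2))) (at w)" for \<sigma>
    using w by (auto intro!: derivative_eq_intros simp: power2_eq_square field_simps)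
  have "(ewald_term \<mu> r has_field_derivative (\<Sum>\<sigma>\<in>{1, -1}. ?D \<sigma>)) (at w)"
    unfolding ewald_term_def[abs_def]
    by (intro DERIV_sum DERIV_cmult DERIV_chain2[OF has_field_derivative_erfc] inner)
  also have "(\<Sum>\<sigma>\<in>{1, -1}. ?D \<sigma>) = (\<Sum>\<sigma>\<in>{1, -1}. - (exp (- (of_real (r\<^sup>2) * w\<^sup>2)) * exp (- \<mu>\<^sup>2 / (4 * w\<^sup>2)) * 2
      / (of_real (8 * pi * r) * of_real (sqrt pi)) * (of_real r - \<sigma> * (\<mu> / (2 * w\<^sup>2)))))"
  proof (rule sum.cong)
    fix \<sigma> :: complex assume "\<sigma> \<in> {1, -1}"
    then have \<sigma>: "\<sigma>\<^sup>2 = 1" by auto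
    have "(w * of_real r + \<sigma> * (\<mu> / (2 * w)))\<^sup>2
        = of_real (r\<^sup>2) * w\<^sup>2 + \<sigma> * \<mu> * of_real r + \<sigma>\<^sup>2 * (\<mu>\<^sup>2 / (4 * w\<^sup>2))"
      using w by (simp add: power2_sum power_mult_distrib power_divide)
    then have "\<sigma> * \<mu> * of_real r + - (w * of_real r + \<sigma> * (\<mu> / (2 * w)))\<^sup>2
        = - (of_real (r\<^sup>2) * w\<^sup>2) + - \<mu>\<^sup>2 / (4 * w\<^sup>2)"
      by (simp add: \<sigma>)
    then have "exp (\<sigma> * \<mu> * of_real r) * exp (- (w * of_real r + \<sigma> * (\<mu> / (2 * w)))\<^sup>2)
        = exp (- (of_real (r\<^sup>2) * w\<^sup>2)) * exp (- \<mu>\<^sup>2 / (4 * w\<^sup>2))"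
      by (simp only: flip: exp_add)
    then show "?D \<sigma> = - (exp (- (of_real (r\<^sup>2) * w\<^sup>2)) * exp (- \<mu>\<^sup>2 / (4 * w\<^sup>2)) * 2
      / (of_real (8 * pi * r) * of_real (sqrt pi)) * (of_real r - \<sigma> * (\<mu> / (2 * w\<^sup>2))))"
      by (simp only: flip: mult.assoc) (simp add: mult_ac)
  qed simp
  also have "\<dots> = - (exp (- (of_real (r\<^sup>2) * w\<^sup>2)) * exp (- \<mu>\<^sup>2 / (4 * w\<^sup>2)) / of_real (2 * pi * sqrt pi))"
  proof -
    have "(\<Sum>\<sigma>\<in>{1, -1::complex}. - (E * 2 / (of_real (8 * pi * r) * of_real (sqrt pi)) * (of_real r - \<sigma> * x)))
        = - (E / of_real (2 * pi * sqrt pi))" for E x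
    proof -
      have "(\<Sum>\<sigma>\<in>{1, -1::complex}. - (Y * (of_real r - \<sigma> * x))) = - (Y * (2 * of_real r))" for Y
        by (simp add: algebra_simps)
      from this[of "E * 2 / (of_real (8 * pi * r) * of_real (sqrt pi))"] show ?thesis
        using r by (simp only:) simp
    qed
    then show ?thesis by blast
  qed
  finally show ?thesis .
qed

text \<open>Integrate the derivative from \<open>\<eta>\<close> to \<open>b\<close> and let
  \<open>b\<close> tend to infinity, where the term vanishes. The assumption on \<open>\<mu>\<close>
  makes the integrand real although \<open>\<mu>\<close> itself may be imaginary.\<close>

lemma ewald_term_eq_gauss_moment:
  assumes \<eta>: "\<eta> > 0" and r: "r > 0" and \<mu>: "\<mu>\<^sup>2 = - of_real c"
  shows "ewald_term \<mu> r (of_real \<eta>) = of_real (1 / (2 * pi * sqrt pi) * gauss_moment \<eta> c 0 (r\<^sup>2))"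
proof -
  define f where "f = (\<lambda>t. exp (- (r\<^sup>2 * t\<^sup>2)) * exp (c / (4 * t\<^sup>2)))"
  define C where "C = 1 / (2 * pi * sqrt pi)"
  have f: "f absolutely_integrable_on {\<eta>..}"
    using absolutely_integrable_gauss_moment[OF \<eta>, of "r\<^sup>2" 0 c] r by (simp add: f_def)
  have eq: "ewald_term \<mu> r (of_real b) - ewald_term \<mu> r (of_real \<eta>) = of_real (- (C * integral {\<eta>..b} f))"
    if b: "b \<ge> \<eta>" for b
  proof (rule has_integral_unique)
    have "((\<lambda>t. ewald_term \<mu> r (of_real t)) has_vector_derivative of_real (- (C * f t))) (at t within {\<eta>..b})"
      if "t \<in> {\<eta>..b}" for t
    proof -
      have "((\<lambda>t. ewald_term \<mu> r (of_real t)) has_vector_derivative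
          - (exp (- (of_real (r\<^sup>2) * (of_real t)\<^sup>2)) * exp (- \<mu>\<^sup>2 / (4 * (of_real t)\<^sup>2)) / of_real (2 * pi * sqrt pi)))
          (at t within {\<eta>..b})"
        using that \<eta> r by (intro has_vector_derivative_real_field ewald_term_has_field_derivative) auto
      then show ?thesis by (simp add: \<mu> C_def f_def exp_of_real[symmetric])
    qed
    then show "((\<lambda>t. complex_of_real (- (C * f t))) has_integral
        ewald_term \<mu> r (of_real b) - ewald_term \<mu> r (of_real \<eta>)) {\<eta>..b}"
      using b by (intro fundamental_theorem_of_calculus) auto
    have "f integrable_on {\<eta>..b}"
      by (intro set_lebesgue_integral_eq_integral set_integrable_subset[OF f]) auto
    then show "((\<lambda>t. complex_of_real (- (C * f t))) has_integral of_real (- (C * integral {\<eta>..b} f))) {\<eta>..b}"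
      by (intro has_integral_of_real has_integral_neg has_integral_mult_right integrable_integral)
  qed
  \<comment> \<open>The arguments are \<open>b * r + \<nu> / b\<close> with
    \<open>\<nu> = \<sigma> * \<mu> / 2\<close>.\<close>
  have "((\<lambda>b. ewald_term \<mu> r (of_real b)) \<longlongrightarrow>
      (\<Sum>\<sigma>\<in>{1, -1::complex}. exp (\<sigma> * \<mu> * of_real r) / of_real (8 * pi * r) * 0)) at_top"
    unfolding ewald_term_def
    using erfc_perturbed_tendsto_0[OF r, of "_ * \<mu> / 2"]
    by (intro tendsto_sum tendsto_mult tendsto_const) simp
  then have "((\<lambda>b. ewald_term \<mu> r (of_real b) - ewald_term \<mu> r (of_real \<eta>)) \<longlongrightarrow>
      0 - ewald_term \<mu> r (of_real \<eta>)) at_top"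
    by (intro tendsto_diff tendsto_const) simp
  moreover have "((\<lambda>b. ewald_term \<mu> r (of_real b) - ewald_term \<mu> r (of_real \<eta>)) \<longlongrightarrow>
      of_real (- (C * integral {\<eta>..} f))) at_top"
  proof (rule Lim_transform_eventually)
    show "((\<lambda>b. complex_of_real (- (C * integral {\<eta>..b} f))) \<longlongrightarrow> of_real (- (C * integral {\<eta>..} f))) at_top"
      by (intro tendsto_intros tendsto_integral_atLeast f)
    show "\<forall>\<^sub>F b in at_top. of_real (- (C * integral {\<eta>..b} f))
        = ewald_term \<mu> r (of_real b) - ewald_term \<mu> r (of_real \<eta>)"
      using eventually_ge_at_top[of \<eta>] by eventually_elim (simp add: eq)
  qed
  ultimately have "0 - ewald_term \<mu> r (of_real \<eta>) = of_real (- (C * integral {\<eta>..} f))"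
    by (intro tendsto_unique) auto
  then show ?thesis by (simp add: C_def f_def gauss_moment_def)
qed

section \<open>Hermite polynomials and mixed partial derivatives\<close>

text \<open>If \<open>L n = \<integral> t ^ n d\<mu>(t)\<close>, then \<open>poly_pairing A x L n = \<integral> t ^ n * poly A (t * x) d\<mu>(t)\<close>; only the
  moments enter, so differentiation in \<open>x\<close> reduces to differentiation of the moments.\<close>

definition poly_pairing :: "real poly \<Rightarrow> real \<Rightarrow> (nat \<Rightarrow> real) \<Rightarrow> nat \<Rightarrow> real" where
  "poly_pairing A x L n = (\<Sum>i\<le>degree A. coeff A i * x ^ i * L (n + i))"

lemma poly_pairing_altdef:
  assumes "degree A \<le> N"
  shows "poly_pairing A x L n = (\<Sum>i\<le>N. coeff A i * x ^ i * L (n + i))"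
  unfolding poly_pairing_def
  by (rule sum.mono_neutral_left) (use assms in \<open>auto simp: not_le coeff_eq_0\<close>)

lemma poly_pairing_0 [simp]: "poly_pairing 0 x L n = 0"
  by (simp add: poly_pairing_def)

lemma poly_pairing_pCons:
  "poly_pairing (pCons a A) x L n = a * L n + x * poly_pairing A x L (n + 1)"
  using degree_pCons_le[of a A]
  by (subst poly_pairing_altdef[where N = "Suc (degree A)"], simp)
     (simp add: poly_pairing_def sum.atMost_Suc_shift sum_distrib_left mult_ac del: sum.atMost_Suc)

lemma poly_pairing_diff:
  "poly_pairing (A - B) x L n = poly_pairing A x L n - poly_pairing B x L n"
proof -
  define N where "N = max (degree A) (degree B)"
  have "degree A \<le> N" "degree B \<le> N" "degree (A - B) \<le> N"
    by (auto simp: N_def intro: degree_diff_le)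
  then show ?thesis
    by (simp add: poly_pairing_altdef[where N = N] sum_subtractf left_diff_distrib)
qed

lemma poly_pairing_add:
  "poly_pairing (A + B) x L n = poly_pairing A x L n + poly_pairing B x L n"
  using poly_pairing_diff[of "A + B" B x L n] by simp

text \<open>For a coordinate that is held fixed: \<open>u\<close> moves only the moments, and the
  pairing is linear in them. The numbers \<open>d\<close> and \<open>k\<close> record the factor and
  the index shift that their derivative brings.\<close>

lemma poly_pairing_has_derivative_fixed:
  assumes "\<And>n. ((\<lambda>u. L u n) has_real_derivative d * M (n + k)) (at u)"
  shows "((\<lambda>u. poly_pairing A x (L u) n) has_real_derivative d * poly_pairing A x M (n + k)) (at u)"
proof -
  have "((\<lambda>u. coeff A i * x ^ i * L u (n + i)) has_real_derivative
      coeff A i * x ^ i * (d * M (n + i + k))) (at u)" for i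
    by (rule DERIV_cmult) (rule assms)
  then have "((\<lambda>u. poly_pairing A x (L u) n) has_real_derivative
      (\<Sum>i\<le>degree A. coeff A i * x ^ i * (d * M (n + i + k)))) (at u)"
    unfolding poly_pairing_def by (intro DERIV_sum)
  then show ?thesis
    by (simp add: poly_pairing_def sum_distrib_left mult_ac add_ac)
qed

text \<open>For the coordinate being differentiated: in terms of integrands, the derivative of
  \<open>poly A (t * u) * exp (- (u^2 * t^2))\<close> is \<open>- t\<close> times
  \<open>2 X A - A'\<close> at \<open>t * u\<close>, times the same exponential. This is the Hermite
  recursion, and the factor \<open>t\<close> is the index shift.\<close>

lemma poly_pairing_has_derivative_diagonal:
  assumes L: "\<And>n. ((\<lambda>u. L u n) has_real_derivative - 2 * u * L u (n + 2)) (at u)"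
  shows "((\<lambda>u. poly_pairing A u (L u) n) has_real_derivative
           - poly_pairing ([:0, 2:] * A - pderiv A) u (L u) (n + 1)) (at u)"
proof (induction A arbitrary: n)
  case 0
  then show ?case by simp
next
  case (pCons a A)
  \<comment> \<open>Applied to \<open>a + X A\<close>, the operator gives
    \<open>(2 a X - A) + X (2 X A - A')\<close>, matching the product rule for
    \<open>a * L u n + u * poly_pairing A u (L u) (n + 1)\<close>.\<close>
  have "[:0, 2:] * pCons a A - pderiv (pCons a A)
      = ([:0, 2 * a:] - A) + pCons 0 ([:0, 2:] * A - pderiv A)"
    by (simp add: pderiv_pCons)
  then have eq: "- poly_pairing ([:0, 2:] * pCons a A - pderiv (pCons a A)) u (L u) (n + 1)
      = a * (- 2 * u * L u (n + 2)) + (1 * poly_pairing A u (L u) (n + 1)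
          + - poly_pairing ([:0, 2:] * A - pderiv A) u (L u) (n + 1 + 1) * u)"
    by (simp add: poly_pairing_add poly_pairing_diff[of "[:0, 2 * a:]"] poly_pairing_pCons)
  show ?case
    unfolding eq poly_pairing_pCons by (intro DERIV_add DERIV_cmult DERIV_mult DERIV_ident L pCons.IH)
qed

text \<open>The integrability conclusion lets the lemma be applied again with
  \<open>poly A (t * x) * g t\<close> as the new weight, once per coordinate.\<close>

lemma poly_pairing_integral:
  assumes int: "\<And>n. (\<lambda>t. t ^ n * g t) integrable_on S"
  shows "(\<lambda>t. t ^ n * (poly A (t * x) * g t)) integrable_on S" (is ?I)
    and "poly_pairing A x (\<lambda>n. integral S (\<lambda>t. t ^ n * g t)) n
           = integral S (\<lambda>t. t ^ n * (poly A (t * x) * g t))"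
proof -
  have "((\<lambda>t. \<Sum>i\<le>degree A. coeff A i * x ^ i * (t ^ (n + i) * g t)) has_integral
      poly_pairing A x (\<lambda>n. integral S (\<lambda>t. t ^ n * g t)) n) S"
    unfolding poly_pairing_def
    by (intro has_integral_sum has_integral_mult_right integrable_integral int) auto
  also have "(\<lambda>t. \<Sum>i\<le>degree A. coeff A i * x ^ i * (t ^ (n + i) * g t))
      = (\<lambda>t. t ^ n * (poly A (t * x) * g t))"
    by (simp add: poly_altdef sum_distrib_left sum_distrib_right power_add power_mult_distrib mult_ac)
  finally show ?I and "poly_pairing A x (\<lambda>n. integral S (\<lambda>t. t ^ n * g t)) n
           = integral S (\<lambda>t. t ^ n * (poly A (t * x) * g t))"
    by (auto dest: integral_unique)
qed

text \<open>The recursion is the operator of \<open>poly_pairing_has_derivative_diagonal\<close>, so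
  one partial derivative advances one Hermite index by one.\<close>

fun hermite_poly :: "nat \<Rightarrow> real poly" where
  "hermite_poly 0 = 1"
| "hermite_poly (Suc n) = [:0, 2:] * hermite_poly n - pderiv (hermite_poly n)"

lemma deriv_gauss_eq_hermite_poly:
  "(deriv ^^ n) (\<lambda>v::real. exp (- (v\<^sup>2))) = (\<lambda>u. (-1) ^ n * poly (hermite_poly n) u * exp (- (u\<^sup>2)))"
proof (induction n)
  case (Suc n)
  have "deriv (\<lambda>u. (-1) ^ n * poly (hermite_poly n) u * exp (- (u\<^sup>2))) u
      = (-1) ^ Suc n * poly (hermite_poly (Suc n)) u * exp (- (u\<^sup>2))" for u
    by (rule DERIV_imp_deriv) (auto intro!: derivative_eq_intros simp: algebra_simps)
  then show ?case
    unfolding funpow.simps comp_apply Suc.IH by blast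
qed simp

lemma hermite_eq_poly: "hermite n u = poly (hermite_poly n) u"
proof -
  have "(-1) ^ n * (-1 :: real) ^ n = 1" "exp (u\<^sup>2) * exp (- u\<^sup>2) = 1"
    by (simp_all flip: power_mult_distrib exp_add)
  then have "((-1) ^ n * (-1) ^ n) * (exp (u\<^sup>2) * exp (- u\<^sup>2)) * poly (hermite_poly n) u
      = poly (hermite_poly n) u"
    by simp
  then show ?thesis
    unfolding hermite_def deriv_gauss_eq_hermite_poly by (simp only: mult_ac)
qed

lemma degree_hermite_poly: "degree (hermite_poly n) \<le> n"
proof (induction n)
  case (Suc n)
  have "degree ([:0, 2:] * hermite_poly n) \<le> Suc n"
    using degree_mult_le[of "[:0, 2:]" "hermite_poly n"] Suc by simp
  moreover have "degree (pderiv (hermite_poly n)) \<le> Suc n"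
    using Suc degree_pderiv[of "hermite_poly n"] by linarith
  ultimately show ?case by (auto intro: degree_diff_le)
qed simp

text \<open>A polynomial is determined by its values, so the description denotes a product of
  rescaled Hermite polynomials. The bound lets the sum over powers stop at the order of
  differentiation.\<close>

lemma degree_hermite_prod_poly: "degree (hermite_prod_poly px py pz R) \<le> px + py + pz"
proof -
  let ?h = "\<lambda>n x. pcompose (hermite_poly n) [:0, x:]"
  have "hermite_prod_poly px py pz R = ?h px (R$1) * ?h py (R$2) * ?h pz (R$3)"
    by (simp flip: poly_eq_poly_eq_iff
        add: fun_eq_iff poly_hermite_prod_poly hermite_eq_poly poly_pcompose)
  moreover have "degree (?h n x) \<le> n" for n x
  proof -
    have "degree (?h n x) \<le> degree (hermite_poly n) * degree [:0, x:]" by (rule degree_pcompose_le)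
    also have "\<dots> \<le> n * 1" by (intro mult_mono degree_hermite_poly) auto
    finally show ?thesis by simp
  qed
  ultimately show ?thesis
    by (auto intro!: order.trans[OF degree_mult_le] add_mono)
qed

section \<open>Pairings in three coordinates and their partial derivatives\<close>

lemma norm_power2_vec3: "(R$1)\<^sup>2 + (R$2)\<^sup>2 + (R$3)\<^sup>2 = (norm R)\<^sup>2" for R :: "real ^ 3"
  unfolding power2_norm_eq_inner inner_vec_def sum_3 by (simp add: power2_eq_square)

text \<open>One nested pairing per coordinate: if \<open>K n s\<close> is the integral of
  \<open>t ^ n * exp (- (s * t^2)) * w t\<close>, this is the integral of that integrand at
  \<open>s = x^2 + y^2 + z^2\<close> times the three Hermite factors at \<open>t * x\<close>,
  \<open>t * y\<close>, \<open>t * z\<close>.\<close>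

definition hermite_pairing3 ::
    "(nat \<Rightarrow> real \<Rightarrow> real) \<Rightarrow> nat \<Rightarrow> nat \<Rightarrow> nat \<Rightarrow> real \<Rightarrow> real \<Rightarrow> real \<Rightarrow> nat \<Rightarrow> real" where
  "hermite_pairing3 K a b c x y z =
     poly_pairing (hermite_poly a) x (poly_pairing (hermite_poly b) y
       (poly_pairing (hermite_poly c) z (\<lambda>n. K n (x\<^sup>2 + y\<^sup>2 + z\<^sup>2))))"

text \<open>Each differentiation of the Gaussian brings a sign and a power of \<open>t\<close>;
  hence the sign and the moment index \<open>a + b + c\<close>.\<close>

definition hermite_pairing ::
    "(nat \<Rightarrow> real \<Rightarrow> real) \<Rightarrow> nat \<Rightarrow> nat \<Rightarrow> nat \<Rightarrow> real ^ 3 \<Rightarrow> real" where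
  "hermite_pairing K a b c R =
     (-1) ^ (a + b + c) * hermite_pairing3 K a b c (R$1) (R$2) (R$3) (a + b + c)"

text \<open>The layer of the moving coordinate is diagonal. Layers inside it only pass on the factor
  \<open>- 2 * u\<close> and the shift by two coming from \<open>K\<close>, with \<open>u\<close>
  the moving coordinate; layers outside it pass on the sign and the shift by one.\<close>

lemma hermite_pairing3_has_derivative:
  assumes K: "\<And>n s. s > 0 \<Longrightarrow> (K n has_real_derivative - K (n + 2) s) (at s)"
    and pos: "x\<^sup>2 + y\<^sup>2 + z\<^sup>2 > 0"
  shows "((\<lambda>x. hermite_pairing3 K a b c x y z n) has_real_derivative
           - hermite_pairing3 K (Suc a) b c x y z (n + 1)) (at x)" (is ?x)
    and "((\<lambda>y. hermite_pairing3 K a b c x y z n) has_real_derivative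
           - hermite_pairing3 K a (Suc b) c x y z (n + 1)) (at y)" (is ?y)
    and "((\<lambda>z. hermite_pairing3 K a b c x y z n) has_real_derivative
           - hermite_pairing3 K a b (Suc c) x y z (n + 1)) (at z)" (is ?z)
proof -
  have "((\<lambda>x. K n (x\<^sup>2 + y\<^sup>2 + z\<^sup>2)) has_real_derivative - K (n + 2) (x\<^sup>2 + y\<^sup>2 + z\<^sup>2) * (2 * x)) (at x)"
    and "((\<lambda>y. K n (x\<^sup>2 + y\<^sup>2 + z\<^sup>2)) has_real_derivative - K (n + 2) (x\<^sup>2 + y\<^sup>2 + z\<^sup>2) * (2 * y)) (at y)"
    and "((\<lambda>z. K n (x\<^sup>2 + y\<^sup>2 + z\<^sup>2)) has_real_derivative - K (n + 2) (x\<^sup>2 + y\<^sup>2 + z\<^sup>2) * (2 * z)) (at z)"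
    for n
    by (rule DERIV_chain2[where f = "K n"], rule K, rule pos, (auto intro!: derivative_eq_intros)[1])+
  then have *: "((\<lambda>x. K n (x\<^sup>2 + y\<^sup>2 + z\<^sup>2)) has_real_derivative - 2 * x * K (n + 2) (x\<^sup>2 + y\<^sup>2 + z\<^sup>2)) (at x)"
    "((\<lambda>y. K n (x\<^sup>2 + y\<^sup>2 + z\<^sup>2)) has_real_derivative - 2 * y * K (n + 2) (x\<^sup>2 + y\<^sup>2 + z\<^sup>2)) (at y)"
    "((\<lambda>z. K n (x\<^sup>2 + y\<^sup>2 + z\<^sup>2)) has_real_derivative - 2 * z * K (n + 2) (x\<^sup>2 + y\<^sup>2 + z\<^sup>2)) (at z)"
    for n
    by (simp_all add: mult_ac)
  show ?x
    unfolding hermite_pairing3_def hermite_poly.simps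
    by (intro poly_pairing_has_derivative_diagonal poly_pairing_has_derivative_fixed *)
  have fixed: "((\<lambda>u. poly_pairing A v (L u) n) has_real_derivative - poly_pairing A v M (n + 1)) (at u)"
    if "\<And>n. ((\<lambda>u. L u n) has_real_derivative - M (n + 1)) (at u)" for A v L M u n
    using poly_pairing_has_derivative_fixed[where d = "-1" and k = 1 and M = M and L = L] that by simp
  show ?y
    unfolding hermite_pairing3_def hermite_poly.simps
    by (rule fixed, rule poly_pairing_has_derivative_diagonal, rule poly_pairing_has_derivative_fixed, rule *)
  show ?z
    unfolding hermite_pairing3_def hermite_poly.simps
    by (rule fixed, rule fixed, rule poly_pairing_has_derivative_diagonal, rule *)
qed

lemma hermite_pairing_has_derivative:
  assumes K: "\<And>n s. s > 0 \<Longrightarrow> (K n has_real_derivative - K (n + 2) s) (at s)"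
    and R: "R \<noteq> 0"
  shows "((\<lambda>t. hermite_pairing K a b c (R + t *\<^sub>R axis 1 1)) has_real_derivative
           hermite_pairing K (Suc a) b c R) (at 0)"
    and "((\<lambda>t. hermite_pairing K a b c (R + t *\<^sub>R axis 2 1)) has_real_derivative
           hermite_pairing K a (Suc b) c R) (at 0)"
    and "((\<lambda>t. hermite_pairing K a b c (R + t *\<^sub>R axis 3 1)) has_real_derivative
           hermite_pairing K a b (Suc c) R) (at 0)"
proof -
  have "(R$1)\<^sup>2 + (R$2)\<^sup>2 + (R$3)\<^sup>2 = (norm R)\<^sup>2"
    by (rule norm_power2_vec3)
  then have pos: "(R$1)\<^sup>2 + (R$2)\<^sup>2 + (R$3)\<^sup>2 > 0" using R by simp
  have [simp]: "axis i (1::real) $ j = (if i = j then 1 else 0)" for i j :: 3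
    by (simp add: axis_def)
  note D = hermite_pairing3_has_derivative[where K = K, OF K pos, where n = "a + b + c"]
  have shift: "((\<lambda>t. f (x + t)) has_real_derivative D) (at 0)"
    if "(f has_real_derivative D) (at x)" for f D and x :: real
    using that DERIV_shift[of f D 0 x] by (simp add: add.commute)
  show "((\<lambda>t. hermite_pairing K a b c (R + t *\<^sub>R axis 1 1)) has_real_derivative
           hermite_pairing K (Suc a) b c R) (at 0)"
    unfolding hermite_pairing_def using DERIV_cmult[OF shift[OF D(1)], of "(-1) ^ (a + b + c)"] by simp
  show "((\<lambda>t. hermite_pairing K a b c (R + t *\<^sub>R axis 2 1)) has_real_derivative
           hermite_pairing K a (Suc b) c R) (at 0)"
    unfolding hermite_pairing_def using DERIV_cmult[OF shift[OF D(2)], of "(-1) ^ (a + b + c)"] by simp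
  show "((\<lambda>t. hermite_pairing K a b c (R + t *\<^sub>R axis 3 1)) has_real_derivative
           hermite_pairing K a b (Suc c) R) (at 0)"
    unfolding hermite_pairing_def using DERIV_cmult[OF shift[OF D(3)], of "(-1) ^ (a + b + c)"] by simp
qed

text \<open>The nested pairings collapse to one integral whose three Hermite factors multiply to
  \<open>hermite_prod_poly\<close> at \<open>t\<close>; sorting by powers of \<open>t\<close>
  returns moments.\<close>

lemma hermite_pairing_integral:
  assumes int: "\<And>n. (\<lambda>t. t ^ n * exp (- ((norm R)\<^sup>2 * t\<^sup>2)) * w t) integrable_on S"
    and K: "\<And>n s. K n s = integral S (\<lambda>t. t ^ n * exp (- (s * t\<^sup>2)) * w t)"
  shows "hermite_pairing K a b c R = (-1) ^ (a + b + c) *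
           (\<Sum>m=0..a + b + c. hermite_coeff a b c R m * K (a + b + c + m) ((norm R)\<^sup>2))"
proof -
  define p where "p = a + b + c"
  define g where "g = (\<lambda>t. exp (- ((norm R)\<^sup>2 * t\<^sup>2)) * w t)"
  have int: "(\<lambda>t. t ^ n * g t) integrable_on S" for n
    using int[of n] by (simp add: g_def mult.assoc)
  have Kg: "K n ((norm R)\<^sup>2) = integral S (\<lambda>t. t ^ n * g t)" for n
    by (simp add: K g_def mult.assoc)
  let ?H = "\<lambda>i n t. poly (hermite_poly n) (t * R$i)"
  have norm: "(R$1)\<^sup>2 + (R$2)\<^sup>2 + (R$3)\<^sup>2 = (norm R)\<^sup>2"
    by (rule norm_power2_vec3)
  have i1: "(\<lambda>t. t ^ n * (?H 3 c t * g t)) integrable_on S" for n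
    by (rule poly_pairing_integral) (rule int)
  have i2: "(\<lambda>t. t ^ n * (?H 2 b t * (?H 3 c t * g t))) integrable_on S" for n
    by (rule poly_pairing_integral) (rule i1)
  have "hermite_pairing3 K a b c (R$1) (R$2) (R$3) p
      = integral S (\<lambda>t. t ^ p * (?H 1 a t * (?H 2 b t * (?H 3 c t * g t))))"
    unfolding hermite_pairing3_def norm Kg
    \<comment> \<open>From the innermost layer outwards; an outer pairing consumes the inner one at
      all moment indices, hence the equalities of functions.\<close>
    unfolding poly_pairing_integral(2)[OF int, THEN ext] poly_pairing_integral(2)[OF i1, THEN ext]
      poly_pairing_integral(2)[OF i2] ..
  also have "\<dots> = integral S (\<lambda>t. \<Sum>m=0..p. hermite_coeff a b c R m * (t ^ (p + m) * g t))"
  proof -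
    have "?H 1 a t * (?H 2 b t * (?H 3 c t * g t))
        = (\<Sum>m=0..p. hermite_coeff a b c R m * t ^ m) * g t" for t
    proof -
      have "?H 1 a t * ?H 2 b t * ?H 3 c t = poly (hermite_prod_poly a b c R) t"
        by (simp add: poly_hermite_prod_poly hermite_eq_poly)
      also have "\<dots> = (\<Sum>m=0..p. hermite_coeff a b c R m * t ^ m)"
        unfolding hermite_coeff_def poly_altdef atMost_atLeast0[symmetric]
        using degree_hermite_prod_poly[of a b c R]
        by (intro sum.mono_neutral_left) (auto simp: p_def not_le coeff_eq_0)
      finally show ?thesis by (simp add: mult.assoc)
    qed
    then show ?thesis
      by (simp add: sum_distrib_left sum_distrib_right power_add mult_ac)
  qed
  also have "\<dots> = (\<Sum>m=0..p. hermite_coeff a b c R m * K (p + m) ((norm R)\<^sup>2))"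
    by (subst integral_sum) (auto simp: Kg intro!: integrable_on_mult_right int)
  finally show ?thesis by (simp add: hermite_pairing_def p_def)
qed

section \<open>Iterated partial derivatives off the origin\<close>

text \<open>Agreement off the origin suffices: a line through a nonzero point avoids the origin for
  small \<open>t\<close>, so the derivative at \<open>t = 0\<close> transfers.\<close>

lemma partial_deriv_of_real:
  assumes f: "\<And>X. X \<noteq> 0 \<Longrightarrow> f X = of_real (G X)"
    and G: "\<And>X. X \<noteq> 0 \<Longrightarrow> ((\<lambda>t. G (X + t *\<^sub>R axis i 1)) has_real_derivative G' X) (at 0)"
  shows "partial_exists_on (- {0}) i f" and "X \<noteq> 0 \<Longrightarrow> partial_deriv i f X = of_real (G' X)"
proof -
  have D: "((\<lambda>t. f (X + t *\<^sub>R axis i 1)) has_vector_derivative of_real (G' X)) (at 0)" if X: "X \<noteq> 0" for X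
  proof -
    have "((\<lambda>t. G (X + t *\<^sub>R axis i 1)) has_vector_derivative G' X) (at 0)"
      using G[OF X] by (simp add: has_real_derivative_iff_has_vector_derivative)
    then have D: "((\<lambda>t. complex_of_real (G (X + t *\<^sub>R axis i 1))) has_vector_derivative of_real (G' X)) (at 0)"
      by (rule bounded_linear.has_vector_derivative[OF bounded_linear_of_real])
    have "isCont (\<lambda>t::real. X + t *\<^sub>R axis i 1) 0" by (intro continuous_intros)
    then have "\<forall>\<^sub>F t in at 0. X + t *\<^sub>R axis i 1 \<noteq> 0"
      unfolding isCont_def by (rule tendsto_imp_eventually_ne) (use X in simp)
    then have ev: "\<forall>\<^sub>F t in nhds 0. X + t *\<^sub>R axis i 1 \<noteq> 0"
      using X by (simp add: eventually_at_filter eventually_mono[rotated])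
         (auto elim!: eventually_mono)
    show ?thesis
      by (rule has_vector_derivative_cong_ev[THEN iffD1, OF _ _ D])
         (use ev X f in \<open>auto elim!: eventually_mono\<close>)
  qed
  then show "partial_exists_on (- {0}) i f"
    unfolding partial_exists_on_def by (blast intro: differentiableI_vector)
  show "X \<noteq> 0 \<Longrightarrow> partial_deriv i f X = of_real (G' X)"
    unfolding partial_deriv_def by (rule vector_derivative_at) (rule D)
qed

text \<open>One derivative at a time, in the third, second, then first coordinate. Each identity
  holds on the whole punctured space, so it can be differentiated again, and existence at every
  stage comes along.\<close>

lemma mixed_partial_hermite_pairing:
  assumes K: "\<And>n s. s > 0 \<Longrightarrow> (K n has_real_derivative - K (n + 2) s) (at s)"
    and f: "\<And>X. X \<noteq> 0 \<Longrightarrow> f X = of_real (C * K 0 ((norm X)\<^sup>2))"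
  shows "mixed_partial_exists_on (- {0}) a b c f"
    and "R \<noteq> 0 \<Longrightarrow> mixed_partial a b c f R = of_real (C * hermite_pairing K a b c R)"
proof -
  note D = hermite_pairing_has_derivative[where K = K, OF K, THEN DERIV_cmult[where c = C]]
  have step: "mixed_partial 0 0 (Suc k) f = partial_deriv 3 (mixed_partial 0 0 k f)"
    "mixed_partial 0 (Suc k) m f = partial_deriv 2 (mixed_partial 0 k m f)"
    "mixed_partial (Suc k) l m f = partial_deriv 1 (mixed_partial k l m f)" for k l m
    by (simp_all add: mixed_partial_def)
  have 0: "mixed_partial 0 0 0 f X = of_real (C * hermite_pairing K 0 0 0 X)" if "X \<noteq> 0" for X
  proof -
    have "(X$1)\<^sup>2 + (X$2)\<^sup>2 + (X$3)\<^sup>2 = (norm X)\<^sup>2"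
      by (rule norm_power2_vec3)
    then show ?thesis
      using f[OF that]
      by (simp add: mixed_partial_def hermite_pairing_def hermite_pairing3_def poly_pairing_def)
  qed
  have 3: "mixed_partial 0 0 m f X = of_real (C * hermite_pairing K 0 0 m X)" if "X \<noteq> 0" for m X
    using that
  proof (induction m arbitrary: X)
    case (Suc m)
    then show ?case unfolding step by (intro partial_deriv_of_real(2)[OF Suc.IH D(3)])
  qed (rule 0)
  have 2: "mixed_partial 0 l m f X = of_real (C * hermite_pairing K 0 l m X)" if "X \<noteq> 0" for l m X
    using that
  proof (induction l arbitrary: X)
    case (Suc l)
    then show ?case unfolding step by (intro partial_deriv_of_real(2)[OF Suc.IH D(2)])
  qed (rule 3)
  have 1: "mixed_partial k l m f X = of_real (C * hermite_pairing K k l m X)" if "X \<noteq> 0" for k l m X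
    using that
  proof (induction k arbitrary: X)
    case (Suc k)
    then show ?case unfolding step by (intro partial_deriv_of_real(2)[OF Suc.IH D(1)])
  qed (rule 2)
  show "mixed_partial_exists_on (- {0}) a b c f"
    unfolding mixed_partial_exists_on_def
    using partial_deriv_of_real(1)[OF 1 D(1)] partial_deriv_of_real(1)[OF 2 D(2)]
      partial_deriv_of_real(1)[OF 3 D(3)] by blast
  show "R \<noteq> 0 \<Longrightarrow> mixed_partial a b c f R = of_real (C * hermite_pairing K a b c R)"
    by (rule 1)
qed

section \<open>Expansion in incomplete Gamma functions\<close>

text \<open>The \<open>r ^ (2 * q)\<close> of the coefficient cancels the one from the substitution,
  and \<open>r ^ (p + m + 1) / r ^ (p + m)\<close> leaves the factor \<open>r\<close>.\<close>

lemma upper_Gamma_series: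
  assumes "\<eta> > 0" and r: "r > 0"
  shows "(\<lambda>q. a * ((c * r^2 / 4) ^ q / fact q)
             * (upper_Gamma ((real p + real m + 1) / 2 - real q) (\<eta>^2 * r^2) / r ^ (p + m)))
           sums (2 * r * (a * gauss_moment \<eta> c (p + m) (r\<^sup>2)))"
proof -
  let ?I = "\<lambda>q. integral {\<eta>..} (\<lambda>t. t ^ (p + m) * exp (- (r\<^sup>2 * t\<^sup>2)) * (1 / t ^ (2 * q)))"
  have "a * ((c * r^2 / 4) ^ q / fact q)
          * (upper_Gamma ((real p + real m + 1) / 2 - real q) (\<eta>^2 * r^2) / r ^ (p + m))
        = 2 * r * (a * ((c / 4) ^ q / fact q * ?I q))" for q
  proof -
    have "(c * r^2 / 4) ^ q = (c / 4) ^ q * r ^ (2 * q)"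
      by (simp only: power_mult power_mult_distrib[symmetric]) simp
    moreover have "upper_Gamma ((real p + real m + 1) / 2 - real q) (\<eta>^2 * r^2)
        = 2 * r ^ (p + m + 1) / r ^ (2 * q) * ?I q"
      using upper_Gamma_eq_gaussian_integral[OF assms, of "p + m" q] by (simp only: of_nat_add)
    ultimately show ?thesis using r by simp
  qed
  then show ?thesis
    using assms by (simp only:) (intro sums_mult gauss_moment_sums; simp)
qed

text \<open>Keeping \<open>S m\<close> abstract covers both an infinite inner sum and a single Gamma
  term. The factor \<open>2 * norm R\<close> in it turns \<open>4 * pi powr (3/2) * norm R\<close>
  into the constant \<open>2 * pi * sqrt pi\<close> of the integral representation.\<close>

lemma mixed_partial_Gaussian_integral:
  fixes R :: "real ^ 3"
  assumes \<eta>: "\<eta> > 0" and R: "R \<noteq> 0"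
    and f: "\<And>X. X \<noteq> 0 \<Longrightarrow> f X = of_real (1 / (2 * pi * sqrt pi) * gauss_moment \<eta> c 0 ((norm X)\<^sup>2))"
    and p: "p = px + py + pz"
    and S: "\<And>m. S m = 2 * norm R * (hermite_coeff px py pz R m * gauss_moment \<eta> c (p + m) ((norm R)\<^sup>2))"
  shows "mixed_partial_exists_on (- {0}) px py pz f"
    and "mixed_partial px py pz f R
           = of_real ((-1) ^ p / (4 * pi powr (3/2) * norm R) * (\<Sum>m=0..p. S m))"
proof -
  note K = gauss_moment_has_derivative[OF \<eta>, of _ c]
  have r: "norm R > 0" using R by simp
  have pi_powr: "pi powr (3/2) = pi * sqrt pi"
    using powr_add[of pi 1 "1/2"] by (simp add: powr_half_sqrt)
  show "mixed_partial_exists_on (- {0}) px py pz f"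
    by (rule mixed_partial_hermite_pairing(1)[where K = "gauss_moment \<eta> c", OF K f])
  have "mixed_partial px py pz f R
      = of_real (1 / (2 * pi * sqrt pi) * hermite_pairing (gauss_moment \<eta> c) px py pz R)"
    by (rule mixed_partial_hermite_pairing(2)[where K = "gauss_moment \<eta> c", OF K f R])
  also have "hermite_pairing (gauss_moment \<eta> c) px py pz R
      = (-1) ^ p * (\<Sum>m=0..p. hermite_coeff px py pz R m * gauss_moment \<eta> c (p + m) ((norm R)\<^sup>2))"
    unfolding p
    by (rule hermite_pairing_integral[OF integrable_gauss_moment gauss_moment_def]) (use \<eta> r in auto)
  also have "1 / (2 * pi * sqrt pi) * \<dots> = (-1) ^ p / (4 * pi powr (3/2) * norm R) * (\<Sum>m=0..p. S m)"
    unfolding S sum_distrib_left[symmetric] pi_powr using r by simp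
  finally show "mixed_partial px py pz f R
      = of_real ((-1) ^ p / (4 * pi powr (3/2) * norm R) * (\<Sum>m=0..p. S m))" .
qed

lemma ewald_H_eq_gauss_moment:
  assumes "\<eta> > 0" "r > 0"
  shows "ewald_H \<eta> \<kappa> r = of_real (1 / (2 * pi * sqrt pi) * gauss_moment \<eta> (\<kappa>\<^sup>2) 0 (r\<^sup>2))"
proof -
  have "ewald_H \<eta> \<kappa> r = ewald_term (\<i> * of_real \<kappa>) r (of_real \<eta>)"
    by (simp add: ewald_H_def ewald_term_def mult.assoc)
  also have "\<dots> = of_real (1 / (2 * pi * sqrt pi) * gauss_moment \<eta> (\<kappa>\<^sup>2) 0 (r\<^sup>2))"
    by (rule ewald_term_eq_gauss_moment) (use assms in \<open>simp_all add: power_mult_distrib\<close>)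
  finally show ?thesis .
qed

lemma ewald_Y_eq_gauss_moment:
  assumes "\<eta> > 0" "r > 0"
  shows "ewald_Y \<eta> \<kappa> r = of_real (1 / (2 * pi * sqrt pi) * gauss_moment \<eta> (- (\<kappa>\<^sup>2)) 0 (r\<^sup>2))"
proof -
  have "ewald_Y \<eta> \<kappa> r = ewald_term (of_real \<kappa>) r (of_real \<eta>)"
    by (simp add: ewald_Y_def ewald_term_def mult.assoc)
  also have "\<dots> = of_real (1 / (2 * pi * sqrt pi) * gauss_moment \<eta> (- (\<kappa>\<^sup>2)) 0 (r\<^sup>2))"
    by (rule ewald_term_eq_gauss_moment) (use assms in simp_all)
  finally show ?thesis .
qed

lemma ewald_C_eq_gauss_moment:
  assumes "\<eta> > 0" "r > 0"
  shows "ewald_C \<eta> r = of_real (1 / (2 * pi * sqrt pi) * gauss_moment \<eta> 0 0 (r\<^sup>2))"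
proof -
  have "ewald_C \<eta> r = ewald_term 0 r (of_real \<eta>)"
    by (simp add: ewald_C_def ewald_term_def)
  also have "\<dots> = of_real (1 / (2 * pi * sqrt pi) * gauss_moment \<eta> 0 0 (r\<^sup>2))"
    by (rule ewald_term_eq_gauss_moment) (use assms in simp_all)
  finally show ?thesis .
qed

text \<open>For \<open>c = 0\<close> the weight is 1 and only the term \<open>q = 0\<close> is
  left.\<close>

lemma upper_Gamma_eq_gauss_moment:
  assumes "\<eta> > 0" "r > 0"
  shows "a * (upper_Gamma ((real p + real m + 1) / 2) (\<eta>^2 * r^2) / r ^ (p + m))
           = 2 * r * (a * gauss_moment \<eta> 0 (p + m) (r\<^sup>2))"
  using upper_Gamma_eq_gaussian_integral[OF assms, of "p + m" 0] assms
  by (simp add: gauss_moment_def)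

theorem mainTheorem1:
  fixes \<eta> \<kappa> :: real and px py pz p :: nat and R :: "real ^ 3"
  assumes "\<eta> > 0" and "\<kappa> > 0" and "p = px + py + pz" and "R \<noteq> 0"
  shows "(mixed_partial_exists_on (- {0}) px py pz (\<lambda>X. ewald_H \<eta> \<kappa> (norm X)) \<and>
      (\<forall>m\<le>p. summable (\<lambda>q. hermite_coeff px py pz R m * ((\<kappa>^2 * (norm R)^2 / 4) ^ q / fact q)
          * (upper_Gamma ((real p + real m + 1) / 2 - real q) (\<eta>^2 * (norm R)^2) / (norm R) ^ (p + m)))) \<and>
      mixed_partial px py pz (\<lambda>X. ewald_H \<eta> \<kappa> (norm X)) R =
        of_real ((-1) ^ p / (4 * pi powr (3/2) * norm R)
          * (\<Sum>m=0..p. \<Sum>q. hermite_coeff px py pz R m * ((\<kappa>^2 * (norm R)^2 / 4) ^ q / fact q)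
          * (upper_Gamma ((real p + real m + 1) / 2 - real q) (\<eta>^2 * (norm R)^2) / (norm R) ^ (p + m)))))
    \<and> (mixed_partial_exists_on (- {0}) px py pz (\<lambda>X. ewald_Y \<eta> \<kappa> (norm X)) \<and>
      (\<forall>m\<le>p. summable (\<lambda>q. hermite_coeff px py pz R m * ((- (\<kappa>^2) * (norm R)^2 / 4) ^ q / fact q)
          * (upper_Gamma ((real p + real m + 1) / 2 - real q) (\<eta>^2 * (norm R)^2) / (norm R) ^ (p + m)))) \<and>
      mixed_partial px py pz (\<lambda>X. ewald_Y \<eta> \<kappa> (norm X)) R =
        of_real ((-1) ^ p / (4 * pi powr (3/2) * norm R)
          * (\<Sum>m=0..p. \<Sum>q. hermite_coeff px py pz R m * ((- (\<kappa>^2) * (norm R)^2 / 4) ^ q / fact q)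
          * (upper_Gamma ((real p + real m + 1) / 2 - real q) (\<eta>^2 * (norm R)^2) / (norm R) ^ (p + m)))))
    \<and> (mixed_partial_exists_on (- {0}) px py pz (\<lambda>X. ewald_C \<eta> (norm X)) \<and>
      mixed_partial px py pz (\<lambda>X. ewald_C \<eta> (norm X)) R =
        of_real ((-1) ^ p / (4 * pi powr (3/2) * norm R)
          * (\<Sum>m=0..p. hermite_coeff px py pz R m
          * (upper_Gamma ((real p + real m + 1) / 2) (\<eta>^2 * (norm R)^2) / (norm R) ^ (p + m)))))"
proof -
  have r: "norm R > 0" and \<eta>: "\<eta> > 0" and R: "R \<noteq> 0" and p: "p = px + py + pz"
    using assms by auto
  note H = ewald_H_eq_gauss_moment[OF \<eta> zero_less_norm_iff[THEN iffD2]]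
    and Y = ewald_Y_eq_gauss_moment[OF \<eta> zero_less_norm_iff[THEN iffD2]]
    and C = ewald_C_eq_gauss_moment[OF \<eta> zero_less_norm_iff[THEN iffD2]]
  \<comment> \<open>One \<open>sums\<close> fact supplies both the summability claims and the values
    of the inner series for Helmholtz and Yukawa, with \<open>c = \<kappa>^2\<close> and
    \<open>c = - (\<kappa>^2)\<close>.\<close>
  note series = upper_Gamma_series[OF \<eta> r]
  note summable = sums_summable[OF series] and suminf = sums_unique[OF series, symmetric]
  show ?thesis
    by (intro conjI allI impI summable
        mixed_partial_Gaussian_integral[OF \<eta> R H p suminf]
        mixed_partial_Gaussian_integral[OF \<eta> R Y p suminf]
        mixed_partial_Gaussian_integral[OF \<eta> R C p upper_Gamma_eq_gauss_moment[OF \<eta> r]])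
qed

end
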